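(* Let $(L,[-,-])$ be a Leibniz algebra over a field $\mathbb{K}$ and let $\theta:L\to L$ be an element of centroid of $(L,[-,-])$. Then $\theta$ is an element of centroid of the associated ternary Leibniz algebra $T(L)=(L,\{-,-,-\})$, where $\{x,y,z\}=[x,[y,z]]$. Moreover, let $[-,-]_1$ be another Leibniz bracket on $L$ which is compatible with $[-,-]$ and such that the ternary Leibniz algebras associated with $(L,[-,-])$ and $(L,[-,-]_1)$ are compatible. If $\theta$ is also an element of centroid of $(L,[-,-]_1)$, then $\theta$ is an element of centroid of the compatible ternary Leibniz algebra $(L,\{-,-,-\},\{-,-,-\}_1)$, where $\{x,y,z\}_1=[x,[y,z]_1]_1$.
   Context: A Leibniz algebra is a vector space with a bilinear bracket satisfying $[[x,y],z]=[x,[y,z]]+[[x,z],y]$. Two Leibniz brackets on $L$ are compatible if every linear combination of them is a Leibniz bracket. An element of centroid of a Leibniz algebra is a linear map $\theta$ with $\theta([x,y])=[\theta(x),y]=[x,\theta(y)]$ for all $x,y$. A ternary Leibniz algebra is a vector space with a trilinear bracket satisfying $\{\{x,y,z\},t,u\}=\{x,y,\{z,t,u\}\}+\{x,\{y,t,u\},z\}+\{\{x,t,u\},y,z\}$; $T(L)$ is always one. Two ternary Leibniz brackets $\{\cdot\}_1,\{\cdot\}_2$ on $L$ are compatible (and then form a compatible ternary Leibniz algebra) if for all $x,y,z,t,u$ \begin{align*} \{\{x,y,z\}_1,t,u\}_2+\{\{x,y,z\}_2,t,u\}_1&=\{x,y,\{z,t,u\}_1\}_2+\{x,y,\{z,t,u\}_2\}_1+\{x,\{y,t,u\}_1,z\}_2\\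 &\quad+\{x,\{y,t,u\}_2,z\}_1+\{\{x,t,u\}_1,y,z\}_2+\{\{x,t,u\}_2,y,z\}_1. \end{align*} An element of centroid of a ternary Leibniz algebra is a linear map $\theta$ with $\theta(\{x,y,z\})=\{\theta(x),y,z\}=\{x,\theta(y),z\}=\{x,y,\theta(z)\}$ for all $x,y,z$; on a compatible ternary Leibniz algebra it must be one for both brackets. *)

theory Defs
  imports Main "HOL.Vector_Spaces"
begin

text \<open>
  The underlying vector space of an algebra is a whole type \<open>'v\<close> with scalar
  multiplication \<open>scale\<close> over an arbitrary field \<open>'k\<close>, of arbitrary dimension and
  characteristic. The Leibniz identity is the right one: every map \<open>\<lambda>x. [x, z]\<close> is a derivation.
\<close>

locale leibniz_algebra = vector_space scale
  for scale :: "'k::field \<Rightarrow> 'v::ab_group_add \<Rightarrow> 'v" +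
  fixes br :: "'v \<Rightarrow> 'v \<Rightarrow> 'v"
  assumes linear_left: "Vector_Spaces.linear scale scale (\<lambda>x. br x y)"
    and linear_right: "Vector_Spaces.linear scale scale (\<lambda>y. br x y)"
    and leibniz: "br (br x y) z = br x (br y z) + br (br x z) y"

definition compatible_leibniz ::
    "('k::field \<Rightarrow> 'v::ab_group_add \<Rightarrow> 'v) \<Rightarrow> ('v \<Rightarrow> 'v \<Rightarrow> 'v) \<Rightarrow> ('v \<Rightarrow> 'v \<Rightarrow> 'v) \<Rightarrow> bool"
  where "compatible_leibniz scale br1 br2 \<longleftrightarrow>
    (\<forall>a b. leibniz_algebra scale (\<lambda>x y. scale a (br1 x y) + scale b (br2 x y)))"

locale leibniz_centroid = leibniz_algebra scale br
  for scale :: "'k::field \<Rightarrow> 'v::ab_group_add \<Rightarrow> 'v" and br :: "'v \<Rightarrow> 'v \<Rightarrow> 'v" +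
  fixes \<theta> :: "'v \<Rightarrow> 'v"
  assumes linear_centroid: "Vector_Spaces.linear scale scale \<theta>"
    and centroid_left: "\<theta> (br x y) = br (\<theta> x) y"
    and centroid_right: "\<theta> (br x y) = br x (\<theta> y)"

locale ternary_leibniz_algebra = vector_space scale
  for scale :: "'k::field \<Rightarrow> 'v::ab_group_add \<Rightarrow> 'v" +
  fixes t :: "'v \<Rightarrow> 'v \<Rightarrow> 'v \<Rightarrow> 'v"
  assumes linear_1: "Vector_Spaces.linear scale scale (\<lambda>x. t x y z)"
    and linear_2: "Vector_Spaces.linear scale scale (\<lambda>y. t x y z)"
    and linear_3: "Vector_Spaces.linear scale scale (\<lambda>z. t x y z)"
    and ternary_leibniz:
      "t (t x y z) u v = t x y (t z u v) + t x (t y u v) z + t (t x u v) y z"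

locale ternary_leibniz_centroid = ternary_leibniz_algebra scale t
  for scale :: "'k::field \<Rightarrow> 'v::ab_group_add \<Rightarrow> 'v" and t :: "'v \<Rightarrow> 'v \<Rightarrow> 'v \<Rightarrow> 'v" +
  fixes \<theta> :: "'v \<Rightarrow> 'v"
  assumes linear_centroid: "Vector_Spaces.linear scale scale \<theta>"
    and centroid_1: "\<theta> (t x y z) = t (\<theta> x) y z"
    and centroid_2: "\<theta> (t x y z) = t x (\<theta> y) z"
    and centroid_3: "\<theta> (t x y z) = t x y (\<theta> z)"

definition associated_ternary :: "('v \<Rightarrow> 'v \<Rightarrow> 'v) \<Rightarrow> 'v \<Rightarrow> 'v \<Rightarrow> 'v \<Rightarrow> 'v"
  where "associated_ternary br x y z = br x (br y z)"

locale compatible_ternary_leibniz_algebra =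
  fst: ternary_leibniz_algebra scale t1 + snd: ternary_leibniz_algebra scale t2
  for scale :: "'k::field \<Rightarrow> 'v::ab_group_add \<Rightarrow> 'v"
    and t1 t2 :: "'v \<Rightarrow> 'v \<Rightarrow> 'v \<Rightarrow> 'v" +
  assumes compatible:
    "t2 (t1 x y z) u v + t1 (t2 x y z) u v =
      t2 x y (t1 z u v) + t1 x y (t2 z u v) +
      t2 x (t1 y u v) z + t1 x (t2 y u v) z +
      t2 (t1 x u v) y z + t1 (t2 x u v) y z"

locale compatible_ternary_leibniz_centroid =
  compatible_ternary_leibniz_algebra scale t1 t2 +
  fst: ternary_leibniz_centroid scale t1 \<theta> + snd: ternary_leibniz_centroid scale t2 \<theta>
  for scale :: "'k::field \<Rightarrow> 'v::ab_group_add \<Rightarrow> 'v"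
    and t1 t2 :: "'v \<Rightarrow> 'v \<Rightarrow> 'v \<Rightarrow> 'v" and \<theta> :: "'v \<Rightarrow> 'v"

end

theory Submission
  imports Defs
begin

text \<open>
  A centroid element moves freely between the two arguments of a bracket; since the ternary
  bracket is a nested binary one, it moves freely between all three arguments
  (\<open>associated_ternary_leibniz_centroid\<close>). Being a centroid element of a ternary Leibniz algebra
  includes that the algebra is one, which holds because right multiplication by \<open>[u, v]\<close> is a
  derivation (\<open>associated_ternary_leibniz_algebra\<close>). On a compatible pair the centroid condition is
  imposed on each ternary bracket separately, so the second part is the first part for
  both brackets.
\<close>

text \<open>
  The map \<open>D = [-, [u, v]]\<close> is a derivation of the binary bracket by the Leibniz identity, and it is
  also the map taking \<open>x\<close> to \<open>{x, u, v}\<close>. A derivation of the binary bracket is one of the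
  nested bracket, and for \<open>D\<close> this is the ternary Leibniz identity.
\<close>

lemma (in leibniz_algebra) associated_ternary_leibniz_algebra:
  "ternary_leibniz_algebra scale (associated_ternary br)"
proof (intro ternary_leibniz_algebra.intro ternary_leibniz_algebra_axioms.intro)
  show "vector_space scale" by (rule vector_space_axioms)
  note comp = Vector_Spaces.linear_compose[unfolded o_def]
  show "Vector_Spaces.linear scale scale (\<lambda>x. associated_ternary br x y z)" for y z
    unfolding associated_ternary_def by (rule linear_left)
  show "Vector_Spaces.linear scale scale (\<lambda>y. associated_ternary br x y z)" for x z
    unfolding associated_ternary_def by (rule comp[OF linear_left linear_right])
  show "Vector_Spaces.linear scale scale (\<lambda>z. associated_ternary br x y z)" for x y
    unfolding associated_ternary_def by (rule comp[OF linear_right linear_right])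
  show "associated_ternary br (associated_ternary br x y z) u v =
      associated_ternary br x y (associated_ternary br z u v) +
      associated_ternary br x (associated_ternary br y u v) z +
      associated_ternary br (associated_ternary br x u v) y z" for x y z u v
  proof -
    define D where "D w = br w (br u v)" for w
    have derivation: "D (br a b) = br a (D b) + br (D a) b" for a b
      unfolding D_def by (rule leibniz)
    have "D (br x (br y z)) = br x (br y (D z) + br (D y) z) + br (D x) (br y z)"
      by (simp only: derivation)
    also have "\<dots> = br x (br y (D z)) + br x (br (D y) z) + br (D x) (br y z)"
      by (simp only: module_hom.add[OF linear_right[unfolded Vector_Spaces.linear_iff_module_hom]])
    finally show ?thesis
      unfolding D_def associated_ternary_def .
  qed
qed

lemma (in leibniz_centroid) associated_ternary_leibniz_centroid:
  "ternary_leibniz_centroid scale (associated_ternary br) \<theta>"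
proof (intro ternary_leibniz_centroid.intro ternary_leibniz_centroid_axioms.intro)
  show "ternary_leibniz_algebra scale (associated_ternary br)"
    by (rule associated_ternary_leibniz_algebra)
  show "Vector_Spaces.linear scale scale \<theta>" by (rule linear_centroid)
  show "\<theta> (associated_ternary br x y z) = associated_ternary br (\<theta> x) y z" for x y z
    unfolding associated_ternary_def by (rule centroid_left)
  show "\<theta> (associated_ternary br x y z) = associated_ternary br x (\<theta> y) z" for x y z
    unfolding associated_ternary_def by (simp only: centroid_right[of x] centroid_left[of y])
  show "\<theta> (associated_ternary br x y z) = associated_ternary br x y (\<theta> z)" for x y z
    unfolding associated_ternary_def by (simp only: centroid_right[of x] centroid_right[of y])
qed

theorem proposition2p15:
  fixes scale :: "'k::field \<Rightarrow> 'v::ab_group_add \<Rightarrow> 'v"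
    and br :: "'v \<Rightarrow> 'v \<Rightarrow> 'v" and \<theta> :: "'v \<Rightarrow> 'v"
  assumes "leibniz_algebra scale br"
    and "leibniz_centroid scale br \<theta>"
  shows "ternary_leibniz_centroid scale (associated_ternary br) \<theta> \<and>
    (\<forall>br1. leibniz_algebra scale br1 \<longrightarrow>
       compatible_leibniz scale br br1 \<longrightarrow>
       compatible_ternary_leibniz_algebra scale (associated_ternary br) (associated_ternary br1) \<longrightarrow>
       leibniz_centroid scale br1 \<theta> \<longrightarrow>
       compatible_ternary_leibniz_centroid scale
         (associated_ternary br) (associated_ternary br1) \<theta>)"
  using assms(2)
  by (blast intro: leibniz_centroid.associated_ternary_leibniz_centroid
      compatible_ternary_leibniz_centroid.intro)

end
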